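(* Let $B\in\mathbb R$ and let $F_i:\overline{I_i}\times\mathbb R\times\mathbb R\to\mathbb R$ be continuous for each $i\in\{1,\dots,K\}$. An upper semi-continuous function $u:\mathcal I\to\mathbb R$ is a sub-solution of $$F_i(x,u,u_{x_i})=0\ \text{ in }I_i\ (i=1,\dots,K),\qquad\sum_{i=1}^Ku_{x_i}=B\ \text{ on }\{0\}$$ if and only if for each $\varphi\in C^2(\mathcal I)$ and any local maximum $x_0$ of $u-\varphi$ the following inequalities are satisfied: $$F_i(x_0,u(x_0),\varphi_{x_i}(x_0))\le0\quad\text{if }x_0\in I_i,$$ $$\min_{1\le i\le K,\ \tilde\theta\in[0,1]}F_i\Big(0,u(0),\varphi_{x_i}(0)+\tilde\theta\Big(\sum_{j=1}^K\varphi_{x_j}(0)-B\Big)^-\Big)\le0\quad\text{if }x_0=0.$$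
   Context: Junction: fix an integer $K\ge1$ and $K$ copies $I_1,\dots,I_K$ of $(-\infty,0)$. $\mathcal I=\bigcup_i\overline{I_i}$ is the union of the half-lines $\overline{I_i}=(-\infty,0]$ glued at $0$, with metric $d(x,y)=|x-y|$ on a common edge and $|x|+|y|$ otherwise. $\varphi_{x_i}$ is the derivative along $\overline{I_i}$ (one-sided at $0$). $C^2(\mathcal I)$: continuous functions on $\mathcal I$ whose restriction to each $\overline{I_i}$ is $C^2$ (derivatives at $0$ along different edges may differ). $a^-=-\min\{a,0\}$. An upper semi-continuous $u:\mathcal I\to\mathbb R$ is a sub-solution if whenever $\varphi\in C^2(\mathcal I)$ and $u-\varphi$ has a local maximum at $x_0\in\mathcal I$: $F_i(x_0,u(x_0),\varphi_{x_i}(x_0))\le0$ if $x_0\in I_i$, and $\min\{\sum_{i=1}^K\varphi_{x_i}(0)-B,\ \min_iF_i(0,u(0),\varphi_{x_i}(0))\}\le0$ if $x_0=0$. *)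

theory Defs
  imports "HOL-Analysis.Analysis"
begin

text \<open>The junction has its edges indexed by a finite type, so \<open>K = CARD('k) \<ge> 1\<close>. It is the
  disjoint union of \<open>CARD('k)\<close> copies of \<open>{..0}\<close> with the points \<open>0\<close> identified.\<close>

definition glued :: "'k \<times> real \<Rightarrow> 'k \<times> real \<Rightarrow> bool" where
  "glued p q \<longleftrightarrow> snd p \<le> 0 \<and> snd q \<le> 0 \<and> snd p = snd q \<and> (fst p = fst q \<or> snd p = 0)"

quotient_type 'k junction = "'k \<times> real" / partial: glued
proof (rule part_equivpI)
  show "\<exists>p :: 'k \<times> real. glued p p"
    by (rule exI[of _ "(undefined, 0)"]) (simp add: glued_def)
  show "symp (glued :: 'k \<times> real \<Rightarrow> 'k \<times> real \<Rightarrow> bool)"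
    by (auto simp: symp_def glued_def)
  show "transp (glued :: 'k \<times> real \<Rightarrow> 'k \<times> real \<Rightarrow> bool)"
    by (auto simp: transp_def glued_def)
qed

text \<open>\<open>edge i x\<close> is the point with coordinate \<open>x\<close> on the \<open>i\<close>-th closed half-line. Only
  \<open>x \<le> 0\<close> is meaningful; \<open>min x 0\<close> merely makes the function total.\<close>

lift_definition edge :: "'k \<Rightarrow> real \<Rightarrow> 'k junction" is "\<lambda>i x. (i, min x 0)"
  by (simp add: glued_def)

lift_definition vertex :: "'k junction" is "(undefined, 0)"
  by (simp add: glued_def)

lemma edge_0 [simp]: "edge i 0 = vertex"
  by transfer (simp add: glued_def)

lemma edge_eq_iff:
  assumes "x \<le> 0" "y \<le> 0"
  shows "edge i x = edge j y \<longleftrightarrow> x = y \<and> (i = j \<or> x = 0)"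
  using assms by transfer (auto simp: glued_def min_def)

lemma junction_cases:
  obtains i x where "x \<le> 0" "p = edge i x"
proof -
  have "\<exists>i x. x \<le> 0 \<and> p = edge i x"
    by transfer (auto simp: glued_def min_def)
  then show ?thesis using that by blast
qed

instantiation junction :: (type) metric_space
begin

lift_definition dist_junction :: "'a junction \<Rightarrow> 'a junction \<Rightarrow> real"
  is "\<lambda>p q. if fst p = fst q then \<bar>snd p - snd q\<bar> else \<bar>snd p\<bar> + \<bar>snd q\<bar>"
  by (auto simp: glued_def)

definition uniformity_junction :: "('a junction \<times> 'a junction) filter" where
  "uniformity_junction = (INF e\<in>{0 <..}. principal {(x, y). dist x y < e})"

definition open_junction :: "'a junction set \<Rightarrow> bool" where
  "open_junction U \<longleftrightarrow> (\<forall>x\<in>U. eventually (\<lambda>(x', y). x' = x \<longrightarrow> y \<in> U) uniformity)"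

instance
proof
  fix p q r :: "'a junction" and U :: "'a junction set"
  show "dist p q = 0 \<longleftrightarrow> p = q"
    by transfer (auto simp: glued_def split: if_splits)
  show "dist p q \<le> dist p r + dist q r"
    by transfer (auto simp: glued_def)
  show "(uniformity :: ('a junction \<times> 'a junction) filter) =
      (INF e\<in>{0 <..}. principal {(x, y). dist x y < e})"
    by (rule uniformity_junction_def)
  show "open U \<longleftrightarrow> (\<forall>x\<in>U. eventually (\<lambda>(x', y). x' = x \<longrightarrow> y \<in> U) uniformity)"
    by (rule open_junction_def)
qed

end

lemma dist_edge:
  assumes "x \<le> 0" "y \<le> 0"
  shows "dist (edge i x) (edge j y) = (if i = j then \<bar>x - y\<bar> else \<bar>x\<bar> + \<bar>y\<bar>)"
  using assms by transfer (simp add: min_def)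

definition deriv_along :: "('k junction \<Rightarrow> real) \<Rightarrow> 'k \<Rightarrow> real \<Rightarrow> real" where
  "deriv_along \<phi> i x = vector_derivative (\<lambda>y. \<phi> (edge i y)) (at x within {..0})"

definition C2_on :: "real set \<Rightarrow> (real \<Rightarrow> real) \<Rightarrow> bool" where
  "C2_on S f \<longleftrightarrow> (\<exists>f' f''.
     (\<forall>x\<in>S. (f has_real_derivative f' x) (at x within S)) \<and>
     (\<forall>x\<in>S. (f' has_real_derivative f'' x) (at x within S)) \<and>
     continuous_on S f'')"

definition C2_junction :: "('k junction \<Rightarrow> real) set" where
  "C2_junction = {\<phi>. continuous_on UNIV \<phi> \<and> (\<forall>i. C2_on {..0} (\<lambda>x. \<phi> (edge i x)))}"

lemma deriv_along_eqI:
  assumes "((\<lambda>y. \<phi> (edge i y)) has_real_derivative D) (at x within {..0})" "x \<le> 0"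
  shows "deriv_along \<phi> i x = D"
proof -
  have "at x within {x-1..x} \<noteq> bot"
    by (simp add: trivial_limit_within islimpt_Icc)
  moreover have "at x within {x-1..x} \<le> at x within {..0}"
    using assms(2) by (intro at_le) auto
  ultimately have "at x within {..0} \<noteq> bot"
    by (auto simp: bot_unique)
  then show ?thesis
    unfolding deriv_along_def
    using assms(1) by (auto intro!: vector_derivative_within
        simp: has_real_derivative_iff_has_vector_derivative)
qed

definition upper_semicontinuous :: "('a::topological_space \<Rightarrow> real) \<Rightarrow> bool" where
  "upper_semicontinuous u \<longleftrightarrow> (\<forall>x c. u x < c \<longrightarrow> (\<forall>\<^sub>F y in nhds x. u y < c))"

definition local_max_at :: "('a::topological_space \<Rightarrow> real) \<Rightarrow> 'a \<Rightarrow> bool" where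
  "local_max_at f x \<longleftrightarrow> (\<forall>\<^sub>F y in nhds x. f y \<le> f x)"

definition neg_part :: "real \<Rightarrow> real" where
  "neg_part a = - min a 0"

definition sub_solution ::
    "('k::finite \<Rightarrow> real \<Rightarrow> real \<Rightarrow> real \<Rightarrow> real) \<Rightarrow> real \<Rightarrow> ('k junction \<Rightarrow> real) \<Rightarrow> bool" where
  "sub_solution F B u \<longleftrightarrow> upper_semicontinuous u \<and>
     (\<forall>\<phi>\<in>C2_junction. \<forall>p. local_max_at (\<lambda>q. u q - \<phi> q) p \<longrightarrow>
        (\<forall>i x. x < 0 \<and> p = edge i x \<longrightarrow> F i x (u p) (deriv_along \<phi> i x) \<le> 0) \<and>
        (p = vertex \<longrightarrow>
           min ((\<Sum>i\<in>UNIV. deriv_along \<phi> i 0) - B)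
               (MIN i. F i 0 (u vertex) (deriv_along \<phi> i 0)) \<le> 0))"

text \<open>For continuous \<open>F i\<close> the infimum below is a minimum.\<close>

lemma INF_attained:
  fixes F :: "'k::finite \<Rightarrow> real \<Rightarrow> real \<Rightarrow> real \<Rightarrow> real"
  assumes "\<And>i. continuous_on ({..0} \<times> UNIV \<times> UNIV) (\<lambda>(x, r, p). F i x r p)"
  obtains i \<theta> where "\<theta> \<in> {0..1}"
    "F i 0 r (d i + \<theta> * c) = (INF (j, t)\<in>UNIV \<times> {0..1}. F j 0 r (d j + t * c))"
    "\<And>j t. t \<in> {0..1} \<Longrightarrow> F i 0 r (d i + \<theta> * c) \<le> F j 0 r (d j + t * c)"
proof -
  let ?G = "\<lambda>j t. F j 0 r (d j + t * c)"
  have cont: "continuous_on {0..1} (?G j)" for j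
  proof -
    have "continuous_on {0..1} ((\<lambda>(x, r, p). F j x r p) \<circ> (\<lambda>t. (0, r, d j + t * c)))"
      by (intro continuous_on_compose continuous_intros
          continuous_on_subset[OF assms]) auto
    then show ?thesis by (simp add: o_def)
  qed
  have "\<exists>\<theta>\<in>{0..1}. \<forall>t\<in>{0..1}. ?G j \<theta> \<le> ?G j t" for j
    by (rule continuous_attains_inf[OF _ _ cont]) auto
  then obtain \<theta> where \<theta>: "\<And>j. \<theta> j \<in> {0..1}" "\<And>j t. t \<in> {0..1} \<Longrightarrow> ?G j (\<theta> j) \<le> ?G j t"
    by metis
  have "(MIN j. ?G j (\<theta> j)) \<in> range (\<lambda>j. ?G j (\<theta> j))"
    by (rule Min_in) auto
  then obtain i where i: "?G i (\<theta> i) = (MIN j. ?G j (\<theta> j))"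
    by (metis (no_types, lifting) imageE)
  have le: "?G i (\<theta> i) \<le> ?G j t" if "t \<in> {0..1}" for j t
  proof -
    have "?G i (\<theta> i) \<le> ?G j (\<theta> j)"
      unfolding i by (rule Min_le) auto
    also have "\<dots> \<le> ?G j t" using \<theta>(2) that by blast
    finally show ?thesis .
  qed
  have "(INF (j, t)\<in>UNIV \<times> {0..1}. ?G j t) = ?G i (\<theta> i)"
    by (rule cInf_eq_minimum) (use \<theta>(1)[of i] le in \<open>force+\<close>)
  then show ?thesis using that[of "\<theta> i" i] \<theta>(1) le by metis
qed

end

theory Submission
  imports Defs
begin

text \<open>Only the condition at the vertex is at stake, since the conditions inside the edges agree.
  Write \<open>D i\<close> for the slopes of the test function at the vertex, \<open>s = (\<Sum>i. D i) - B\<close> and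
  \<open>c = neg_part s\<close>.

  If \<open>s > 0\<close>, then \<open>c = 0\<close> and the two vertex conditions coincide, and if \<open>s \<le> 0\<close>, the condition of
  a sub-solution holds trivially. This gives one implication.

  For the other one, suppose that \<open>F i 0 (u vertex) q > 0\<close> for all \<open>i\<close> and all slopes \<open>q\<close> between
  \<open>D i\<close> and \<open>D i + c\<close>. By continuity the inequality persists near the vertex, for values close to
  \<open>u vertex\<close> and for slightly more slopes (\<open>pos_near_segment\<close>), so no test function with such a slope
  touches \<open>u\<close> from above at such a point inside an edge. As \<open>u\<close> lies below a line of slope slightly
  less than \<open>D i\<close> near the vertex on the edge \<open>i\<close>, this forces \<open>u\<close> to lie below the line of slope
  \<open>D i + c + \<epsilon>\<close> as well (\<open>steeper_line_above\<close>): otherwise a convex arc whose slopes are all in the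
  forbidden range could be slid into contact with \<open>u\<close>. Hence the function that is
  linear with slope \<open>D i + c + \<epsilon>\<close> on each edge is an admissible test function at the vertex. The
  sum of its slopes exceeds \<open>B\<close>, because \<open>s + K * c \<ge> 0\<close> for \<open>K \<ge> 1\<close> edges, and \<open>F i\<close> is positive
  at each of its slopes. This contradicts the definition of a sub-solution.\<close>

section \<open>Neighbourhoods in the junction\<close>

lemma dist_edge_same_le: "dist (edge i x) (edge i y) \<le> \<bar>x - y\<bar>"
proof -
  have "dist (edge i x) (edge i y) = \<bar>min x 0 - min y 0\<bar>"
    by transfer simp
  then show ?thesis
    by (auto simp: min_def)
qed

lemma continuous_on_edge: "continuous_on S (edge i)"
  by (rule lipschitz_on_continuous_on[of 1], rule lipschitz_onI)
     (auto simp: dist_real_def dist_edge_same_le)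

lemma eventually_nhds_edge:
  assumes "x < 0" "\<forall>\<^sub>F y in nhds x. P (edge i y)"
  shows "\<forall>\<^sub>F p in nhds (edge i x). P p"
proof -
  obtain d where d: "d > 0" "\<And>y. dist y x < d \<Longrightarrow> P (edge i y)"
    using assms(2) unfolding eventually_nhds_metric by blast
  have "P p" if "dist p (edge i x) < min d (- x)" for p
  proof -
    obtain j y where y: "y \<le> 0" "p = edge j y"
      by (rule junction_cases[of p])
    have "j = i"
      using that assms(1) y by (auto simp: dist_edge split: if_splits)
    then show ?thesis
      using that assms(1) y d(2)[of y] by (auto simp: dist_edge dist_real_def)
  qed
  then show ?thesis
    unfolding eventually_nhds_metric using d(1) assms(1)
    by (intro exI[of _ "min d (- x)"]) auto
qed

lemma eventually_at_left_0_real: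
  "(\<forall>\<^sub>F x in at_left (0::real). P x) \<longleftrightarrow> (\<exists>d>0. \<forall>x. - d < x \<and> x < 0 \<longrightarrow> P x)"
proof -
  have "(\<forall>\<^sub>F x in at_left (0::real). P x) \<longleftrightarrow> (\<exists>b<0. \<forall>y>b. y < 0 \<longrightarrow> P y)"
    by (rule eventually_at_left[of "-1"]) simp
  also have "\<dots> \<longleftrightarrow> (\<exists>d>0. \<forall>x. - d < x \<and> x < 0 \<longrightarrow> P x)"
  proof
    assume "\<exists>b<0. \<forall>y>b. y < 0 \<longrightarrow> P y"
    then obtain b where "b < 0" "\<forall>y>b. y < 0 \<longrightarrow> P y"
      by blast
    then show "\<exists>d>0. \<forall>x. - d < x \<and> x < 0 \<longrightarrow> P x"
      by (intro exI[of _ "- b"]) auto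
  next
    assume "\<exists>d>0. \<forall>x. - d < x \<and> x < 0 \<longrightarrow> P x"
    then obtain d where "d > 0" "\<forall>x. - d < x \<and> x < 0 \<longrightarrow> P x"
      by blast
    then show "\<exists>b<0. \<forall>y>b. y < 0 \<longrightarrow> P y"
      by (intro exI[of _ "- d"]) auto
  qed
  finally show ?thesis .
qed

lemma eventually_nhds_vertex_iff:
  fixes P :: "'k::finite junction \<Rightarrow> bool"
  shows "(\<forall>\<^sub>F p in nhds vertex. P p) \<longleftrightarrow> P vertex \<and> (\<forall>i. \<forall>\<^sub>F x in at_left 0. P (edge i x))"
proof
  assume ev: "\<forall>\<^sub>F p in nhds vertex. P p"
  have "((\<lambda>x. edge i x) \<longlongrightarrow> vertex) (at_left 0)" for i :: 'k
  proof (rule tendsto_within_subset)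
    show "(edge i \<longlongrightarrow> vertex) (at 0)"
      using continuous_on_edge[of UNIV i] unfolding continuous_on_def by (metis UNIV_I edge_0)
  qed simp
  then show "P vertex \<and> (\<forall>i. \<forall>\<^sub>F x in at_left 0. P (edge i x))"
    using ev eventually_nhds_x_imp_x[OF ev]
    by (auto simp: filterlim_iff)
next
  assume *: "P vertex \<and> (\<forall>i. \<forall>\<^sub>F x in at_left 0. P (edge i x))"
  then have "\<forall>\<^sub>F x in at_left 0. \<forall>i. P (edge i x)"
    by (intro eventually_all_finite) blast
  then obtain d where d: "d > 0" "\<And>x i. - d < x \<Longrightarrow> x < 0 \<Longrightarrow> P (edge i x)"
    unfolding eventually_at_left_0_real by blast
  have "P p" if "dist p vertex < d" for p
  proof -
    obtain j y where y: "y \<le> 0" "p = edge j y"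
      by (rule junction_cases[of p])
    have "dist p vertex = \<bar>y\<bar>"
      using y dist_edge[of y 0 j j] by simp
    then show ?thesis
      using that y d(2)[of y j] * by (cases "y = 0") auto
  qed
  then show "\<forall>\<^sub>F p in nhds vertex. P p"
    unfolding eventually_nhds_metric using d(1) by blast
qed

section \<open>Test functions with prescribed restrictions to the edges\<close>

text \<open>The projection of the junction onto the \<open>i\<close>-th edge that collapses all other edges to the
  vertex. It turns functions of one real variable into functions on the junction.\<close>

lift_definition coord :: "'k \<Rightarrow> 'k junction \<Rightarrow> real"
  is "\<lambda>i p. if fst p = i then snd p else 0"
  by (auto simp: glued_def)

lemma coord_edge: "x \<le> 0 \<Longrightarrow> coord i (edge j x) = (if j = i then x else 0)"
  by transfer auto

lemma coord_nonpos: "coord i p \<le> 0"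
  by transfer (auto simp: glued_def)

lemma continuous_on_coord: "continuous_on S (coord i)"
proof -
  have "dist (coord i p) (coord i q) \<le> dist p q" for p q
    unfolding dist_real_def by transfer auto
  then show ?thesis
    by (intro lipschitz_on_continuous_on[of 1] lipschitz_onI) auto
qed

definition sum_along :: "('k::finite \<Rightarrow> real \<Rightarrow> real) \<Rightarrow> 'k junction \<Rightarrow> real" where
  "sum_along f p = (\<Sum>i\<in>UNIV. f i (coord i p))"

lemma sum_along_edge:
  assumes "x \<le> 0"
  shows "sum_along f (edge i x) = f i x + (\<Sum>j\<in>UNIV - {i}. f j 0)"
  using assms unfolding sum_along_def
  by (subst sum.remove[of _ i]) (auto simp: coord_edge intro!: sum.cong)

lemma has_derivative_sum_along:
  assumes "(f i has_real_derivative D) (at x within {..0})" "x \<le> 0"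
  shows "((\<lambda>y. sum_along f (edge i y)) has_real_derivative D) (at x within {..0})"
proof -
  have "((\<lambda>y. f i y + (\<Sum>j\<in>UNIV - {i}. f j 0)) has_real_derivative D) (at x within {..0})"
    using DERIV_add[OF assms(1) DERIV_const] by simp
  then show ?thesis
    by (rule has_field_derivative_transform_within[OF _ zero_less_one])
       (use assms(2) in \<open>auto simp: sum_along_edge\<close>)
qed

lemma sum_along_in_C2_junction:
  assumes "\<And>i. C2_on {..0} (f i)"
  shows "sum_along f \<in> C2_junction"
proof -
  have "continuous_on {..0} (f i)" for i
    using assms[of i] unfolding C2_on_def
    using DERIV_continuous_on by blast
  then have "continuous_on UNIV (\<lambda>p. f i (coord i p))" for i
    by (rule continuous_on_compose2[OF _ continuous_on_coord]) (auto simp: coord_nonpos)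
  then have "continuous_on UNIV (sum_along f)"
    unfolding sum_along_def by (intro continuous_on_sum)
  moreover have "C2_on {..0} (\<lambda>x. sum_along f (edge i x))" for i
  proof -
    obtain f' f'' where
      "\<forall>x\<in>{..0}. (f i has_real_derivative f' x) (at x within {..0})"
      "\<forall>x\<in>{..0}. (f' has_real_derivative f'' x) (at x within {..0})" "continuous_on {..0} f''"
      using assms[of i] unfolding C2_on_def by blast
    then show ?thesis
      unfolding C2_on_def
      by (intro exI[of _ f'] exI[of _ f'']) (simp add: has_derivative_sum_along)
  qed
  ultimately show ?thesis
    unfolding C2_junction_def by blast
qed

lemma has_derivative_deriv_along:
  assumes "\<phi> \<in> C2_junction" "x \<le> 0"
  shows "((\<lambda>y. \<phi> (edge i y)) has_real_derivative deriv_along \<phi> i x) (at x within {..0})"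
proof -
  obtain D where "((\<lambda>y. \<phi> (edge i y)) has_real_derivative D) (at x within {..0})"
    using assms unfolding C2_junction_def C2_on_def by blast
  then show ?thesis
    by (simp add: deriv_along_eqI[OF _ assms(2)])
qed

section \<open>Upper semi-continuity\<close>

lemma upper_semicontinuous_diff_continuous:
  fixes u \<phi> :: "'a::topological_space \<Rightarrow> real"
  assumes "upper_semicontinuous u" "continuous_on UNIV \<phi>"
  shows "upper_semicontinuous (\<lambda>x. u x - \<phi> x)"
  unfolding upper_semicontinuous_def
proof (intro allI impI)
  fix x c assume "u x - \<phi> x < c"
  then obtain t where t: "u x < t" "t < c + \<phi> x"
    using dense[of "u x" "c + \<phi> x"] by auto
  have "\<forall>\<^sub>F y in nhds x. t - c < \<phi> y"
    using assms(2) t(2) continuous_on_open_vimage[of UNIV \<phi>]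
    unfolding eventually_nhds
    by (intro exI[of _ "\<phi> -` {t - c<..}"]) auto
  moreover have "\<forall>\<^sub>F y in nhds x. u y < t"
    using assms(1) t(1) unfolding upper_semicontinuous_def by blast
  ultimately show "\<forall>\<^sub>F y in nhds x. u y - \<phi> y < c"
    by eventually_elim simp
qed

lemma upper_semicontinuous_attains_max:
  fixes f :: "'a::topological_space \<Rightarrow> real"
  assumes "upper_semicontinuous f" "compact S" "S \<noteq> {}"
  shows "\<exists>x\<in>S. \<forall>y\<in>S. f y \<le> f x"
proof (rule ccontr)
  assume "\<not> ?thesis"
  then have cover: "S \<subseteq> (\<Union>y\<in>S. {x. f x < f y})"
    by (auto simp: not_le)
  have "open {x. f x < c}" for c
  proof (subst open_subopen, intro ballI)
    fix x assume "x \<in> {x. f x < c}"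
    then have "\<forall>\<^sub>F y in nhds x. f y < c"
      using assms(1) unfolding upper_semicontinuous_def by blast
    then show "\<exists>T. open T \<and> x \<in> T \<and> T \<subseteq> {x. f x < c}"
      unfolding eventually_nhds by blast
  qed
  then obtain T where T: "T \<subseteq> S" "finite T" "S \<subseteq> (\<Union>y\<in>T. {x. f x < f y})"
    by (rule compactE_image[OF assms(2) _ cover])
  have "T \<noteq> {}"
    using T(3) assms(3) by auto
  then obtain y where y: "y \<in> T" "f y = Max (f ` T)"
    using Max_in[of "f ` T"] T(2) by fastforce
  obtain z where "z \<in> T" "f y < f z"
    using T(1,3) y(1) by blast
  then show False
    using y(2) T(2) by (simp add: leD)
qed

section \<open>Slopes of functions touching from above\<close>

lemma below_line_left_of_0:
  fixes f :: "real \<Rightarrow> real"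
  assumes "(f has_real_derivative D) (at 0 within {..0})" "q < D"
  shows "\<forall>\<^sub>F x in at_left 0. f x < f 0 + q * x"
proof -
  have "((\<lambda>x. f x - q * x) has_real_derivative D - q) (at 0 within {..0})"
    using assms(1) by (auto intro!: derivative_eq_intros)
  from has_real_derivative_pos_inc_left[OF this] obtain d where
    d: "d > 0" "\<And>h. h > 0 \<Longrightarrow> h < d \<Longrightarrow> f (- h) - q * - h < f 0"
    using assms(2) by auto
  then have "f x < f 0 + q * x" if "- d < x" "x < 0" for x
    using d(2)[of "- x"] that by auto
  then show ?thesis
    unfolding eventually_at_left_0_real using d(1) by blast
qed

text \<open>The critical slope argument. If \<open>u\<close> rose above the steeper line arbitrarily close to the vertex,
  take an arc that starts at the value of \<open>u\<close> in the vertex with slope \<open>q'\<close> and bends quickly to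
  slopes close to \<open>p'\<close>. Near the vertex it is below the line of slope \<open>q\<close>, hence below \<open>u\<close> at some
  points, but at some fixed distance it is above the line of slope \<open>p\<close>, hence above \<open>u\<close>. The largest
  excess of \<open>u\<close> over the arc would then be attained inside the edge, where the slope of the arc is
  between \<open>p'\<close> and \<open>q'\<close>.\<close>

lemma steeper_line_above:
  fixes u :: "'k::finite junction \<Rightarrow> real"
  assumes usc: "upper_semicontinuous u"
    and slopes: "p' < p" "q < q'" "p' < q'"
    and below: "\<forall>\<^sub>F x in at_left 0. u (edge i x) \<le> u vertex + p * x"
    and "e > 0"
    and no_touch: "\<And>\<phi> x. \<phi> \<in> C2_junction \<Longrightarrow> local_max_at (\<lambda>r. u r - \<phi> r) (edge i x) \<Longrightarrow>
      - e \<le> x \<Longrightarrow> x < 0 \<Longrightarrow> \<bar>u (edge i x) - u vertex\<bar> \<le> e \<Longrightarrow> deriv_along \<phi> i x \<notin> {p'..q'}"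
  shows "\<forall>\<^sub>F x in at_left 0. u (edge i x) \<le> u vertex + q * x"
proof -
  \<comment> \<open>The factor \<open>L\<close> bounds the variation of \<open>u\<close> at a contact point, where \<open>u\<close> is between the lines
    of slopes \<open>p\<close> and \<open>q'\<close>.\<close>
  define L where "L = 1 + \<bar>p\<bar> + \<bar>q'\<bar>"
  have "L \<ge> 1"
    by (simp add: L_def)
  obtain d where d: "d > 0" "\<And>x. - d < x \<Longrightarrow> x < 0 \<Longrightarrow> u (edge i x) \<le> u vertex + p * x"
    using below unfolding eventually_at_left_0_real by blast
  define r where "r = min (d / 2) (e / L)"
  have r: "r > 0" "r < d" "L * r \<le> e"
    using d(1) \<open>e > 0\<close> \<open>L \<ge> 1\<close> by (auto simp: r_def min_def field_simps)
  have "r \<le> e"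
    using r \<open>L \<ge> 1\<close> mult_right_mono[of 1 L r] by linarith
  have u_le: "u (edge i x) \<le> u vertex + p * x" if "- r \<le> x" "x \<le> 0" for x
    using d(2)[of x] that r by (cases "x = 0") auto
  \<comment> \<open>The arc bends within a distance of order \<open>a\<close>; this \<open>a\<close> is so small that at \<open>- r\<close> the arc is
    still above the line of slope \<open>p\<close>.\<close>
  obtain a where "0 < a" "a < (p - p') * r / (q' - p')"
    using dense[of 0 "(p - p') * r / (q' - p')"] slopes r(1) by auto
  then have a: "a > 0" "(q' - p') * a < (p - p') * r"
    using slopes by (simp_all add: pos_less_divide_eq mult.commute)
  define \<psi> where "\<psi> = (\<lambda>x. p' * x + (q' - p') * (a * (exp (x / a) - 1)))"
  define \<psi>' where "\<psi>' = (\<lambda>x. p' + (q' - p') * exp (x / a))"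
  have \<psi>_deriv: "(\<psi> has_real_derivative \<psi>' x) (at x within S)" for x S
    unfolding \<psi>_def \<psi>'_def using a(1) by (auto intro!: derivative_eq_intros)
  have "(\<psi>' has_real_derivative (q' - p') * exp (x / a) / a) (at x within S)" for x S
    unfolding \<psi>'_def using a(1) by (auto intro!: derivative_eq_intros)
  then have \<psi>_C2: "C2_on {..0} \<psi>"
    unfolding C2_on_def using \<psi>_deriv a(1)
    by (intro exI[of _ \<psi>'] exI[of _ "\<lambda>x. (q' - p') * exp (x / a) / a"])
       (auto intro!: continuous_intros)
  have \<psi>_0: "\<psi> 0 = 0" "\<psi>' 0 = q'"
    by (auto simp: \<psi>_def \<psi>'_def)
  have \<psi>_ge: "q' * x \<le> \<psi> x" for x
  proof -
    have "x \<le> a * (exp (x / a) - 1)"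
      using exp_ge_add_one_self[of "x / a"] a(1) by (simp add: field_simps)
    then have "(q' - p') * x \<le> (q' - p') * (a * (exp (x / a) - 1))"
      using slopes by (intro mult_left_mono) auto
    then show ?thesis
      by (simp add: \<psi>_def algebra_simps)
  qed
  have \<psi>_left: "- (p * r) < \<psi> (- r)"
  proof -
    have "(q' - p') * (a * (exp (- r / a) - 1)) \<ge> (q' - p') * (a * (0 - 1))"
      using slopes a(1) by (intro mult_left_mono) auto
    then show ?thesis
      using a(2) by (simp add: \<psi>_def algebra_simps)
  qed
  define f where "f = (\<lambda>j. if j = i then \<psi> else (\<lambda>_. 0))"
  define \<phi> where "\<phi> = sum_along f"
  have "C2_on S (\<lambda>_. 0)" for S
    unfolding C2_on_def by (intro exI[of _ "\<lambda>_. 0"]) auto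
  then have \<phi>_C2: "\<phi> \<in> C2_junction"
    unfolding \<phi>_def using \<psi>_C2 by (intro sum_along_in_C2_junction) (auto simp: f_def)
  have \<phi>_edge: "\<phi> (edge i x) = \<psi> x" if "x \<le> 0" for x
    unfolding \<phi>_def using that by (simp add: sum_along_edge f_def)
  have \<phi>_deriv: "deriv_along \<phi> i x = \<psi>' x" if "x \<le> 0" for x
    unfolding \<phi>_def using that \<psi>_deriv
    by (intro deriv_along_eqI has_derivative_sum_along) (auto simp: f_def)
  have "compact (edge i ` {- r..0})"
    by (intro compact_continuous_image continuous_on_edge) auto
  then obtain m where m: "- r \<le> m" "m \<le> 0"
    and m_max: "\<And>x. - r \<le> x \<Longrightarrow> x \<le> 0 \<Longrightarrow> u (edge i x) - \<psi> x \<le> u (edge i m) - \<psi> m"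
    using upper_semicontinuous_attains_max[of "\<lambda>r. u r - \<phi> r" "edge i ` {- r..0}"]
      upper_semicontinuous_diff_continuous[OF usc, of \<phi>] \<phi>_C2 r(1)
    by (auto simp: C2_junction_def \<phi>_edge)
  \<comment> \<open>A maximum point other than the vertex would be a forbidden contact; a maximum at the vertex
    says that \<open>u\<close> is below the arc.\<close>
  have "m = 0"
  proof (rule ccontr)
    assume "m \<noteq> 0"
    have ge: "u vertex + \<psi> m \<le> u (edge i m)"
      using m_max[of 0] r(1) \<psi>_0 by simp
    have "m \<noteq> - r"
      using ge u_le[of "- r"] \<psi>_left r(1) by auto
    then have m': "- r < m" "m < 0"
      using m \<open>m \<noteq> 0\<close> by auto
    have "\<forall>\<^sub>F y in nhds m. y \<in> {- r<..<0}"
      using m' by (intro eventually_nhds_in_open) auto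
    then have "local_max_at (\<lambda>r. u r - \<phi> r) (edge i m)"
      unfolding local_max_at_def using m' m_max
      by (intro eventually_nhds_edge) (auto elim!: eventually_mono simp: \<phi>_edge)
    moreover have "\<bar>u (edge i m) - u vertex\<bar> \<le> e"
    proof -
      have "\<bar>s * m\<bar> \<le> L * r" if "\<bar>s\<bar> \<le> L" for s
        unfolding abs_mult using m' that by (intro mult_mono) auto
      then have "\<bar>p * m\<bar> \<le> L * r" "\<bar>q' * m\<bar> \<le> L * r"
        by (auto simp: L_def)
      then show ?thesis
        using ge u_le[of m] \<psi>_ge[of m] m' r(3) by auto
    qed
    moreover have "\<psi>' m \<in> {p'..q'}"
    proof -
      have "exp (m / a) \<le> 1"
        using a(1) m' by (simp add: divide_nonpos_pos)
      then have "0 \<le> (q' - p') * exp (m / a)" "(q' - p') * exp (m / a) \<le> q' - p'"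
        using slopes by (simp_all add: mult_left_le)
      then show ?thesis
        unfolding \<psi>'_def atLeastAtMost_iff by linarith
    qed
    ultimately show False
      using no_touch[OF \<phi>_C2, of m] m' \<open>r \<le> e\<close> \<phi>_deriv[of m] by auto
  qed
  have "\<forall>\<^sub>F x in at_left 0. \<psi> x < \<psi> 0 + q * x"
    using \<psi>_deriv[of 0] \<psi>_0 slopes by (intro below_line_left_of_0) auto
  moreover have "\<forall>\<^sub>F x in at_left 0. - r < x \<and> x < 0"
    unfolding eventually_at_left_0_real using r(1) by blast
  ultimately show ?thesis
  proof eventually_elim
    case (elim x)
    then show ?case
      using m_max[of x] \<psi>_0 \<open>m = 0\<close> by auto
  qed
qed

section \<open>The two vertex conditions\<close>

lemma pos_near_segment:
  fixes F :: "real \<Rightarrow> real \<Rightarrow> real \<Rightarrow> real"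
  assumes cont: "continuous_on ({..0} \<times> UNIV \<times> UNIV) (\<lambda>(x, r, p). F x r p)"
    and "c \<ge> 0"
    and pos: "\<And>q. D \<le> q \<Longrightarrow> q \<le> D + c \<Longrightarrow> F 0 r0 q > 0"
  obtains e where "e > 0"
    "\<And>x r q. - e \<le> x \<Longrightarrow> x \<le> 0 \<Longrightarrow> \<bar>r - r0\<bar> \<le> e \<Longrightarrow> D - e \<le> q \<Longrightarrow> q \<le> D + c + e \<Longrightarrow> F x r q > 0"
proof -
  let ?S = "{..0::real} \<times> (UNIV :: real set) \<times> (UNIV :: real set)"
  let ?G = "\<lambda>(x, r, p). F x r p"
  let ?A = "{0::real} \<times> {r0} \<times> {D..D + c}"
  obtain T where T: "open T" "T \<inter> ?S = ?G -` {0<..} \<inter> ?S"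
    using cont unfolding continuous_on_open_invariant by (meson open_greaterThan)
  have "?A \<subseteq> T"
    using T(2) pos by fastforce
  moreover have "compact ?A" "?A \<noteq> {}"
    using \<open>c \<ge> 0\<close> by (auto intro!: compact_Times)
  ultimately obtain e where e: "e > 0" "{z. infdist z ?A \<le> e} \<subseteq> T"
    using compact_in_open_separated[of ?A T] T(1) by blast
  show ?thesis
  proof
    show "e / 3 > 0"
      using e(1) by simp
    fix x r q
    assume near: "- (e / 3) \<le> x" "x \<le> 0" "\<bar>r - r0\<bar> \<le> e / 3" "D - e / 3 \<le> q" "q \<le> D + c + e / 3"
    define q0 where "q0 = max D (min q (D + c))"
    have "dist (x, r, q) (0, r0, q0) \<le> \<bar>x\<bar> + (\<bar>r - r0\<bar> + \<bar>q - q0\<bar>)"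
      using norm_Pair_le[of x "(r - r0, q - q0)"] norm_Pair_le[of "r - r0" "q - q0"]
      by (simp add: dist_norm)
    also have "\<dots> \<le> e"
      using near \<open>c \<ge> 0\<close> by (auto simp: q0_def max_def min_def)
    finally have "infdist (x, r, q) ?A \<le> e"
      using infdist_le2[of "(0, r0, q0)" ?A] \<open>c \<ge> 0\<close> by (auto simp: q0_def)
    then have "(x, r, q) \<in> T \<inter> ?S"
      using e(2) near by auto
    then show "F x r q > 0"
      unfolding T(2) by simp
  qed
qed

lemma INF_nonpos_iff:
  fixes F :: "'k::finite \<Rightarrow> real \<Rightarrow> real \<Rightarrow> real \<Rightarrow> real"
  assumes "\<And>i. continuous_on ({..0} \<times> UNIV \<times> UNIV) (\<lambda>(x, r, p). F i x r p)"
  shows "(INF (i, \<theta>)\<in>UNIV \<times> {0..1}. F i 0 r (d i + \<theta> * c)) \<le> 0 \<longleftrightarrow>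
    (\<exists>i. \<exists>\<theta>\<in>{0..1}. F i 0 r (d i + \<theta> * c) \<le> 0)"
proof -
  obtain i \<theta> where "\<theta> \<in> {0..1}"
    and attained: "F i 0 r (d i + \<theta> * c) = (INF (j, t)\<in>UNIV \<times> {0..1}. F j 0 r (d j + t * c))"
    and least: "\<And>j t. t \<in> {0..1} \<Longrightarrow> F i 0 r (d i + \<theta> * c) \<le> F j 0 r (d j + t * c)"
    by (rule INF_attained[where F = F and d = d and c = c and r = r]) (use assms in blast)+
  show ?thesis
    unfolding attained[symmetric] using least order_trans \<open>\<theta> \<in> {0..1}\<close> by blast
qed

lemma min_flux_nonpos_iff:
  fixes f :: "'k::finite \<Rightarrow> real"
  shows "min s (MIN i. f i) \<le> 0 \<longleftrightarrow> s \<le> 0 \<or> (\<exists>i. f i \<le> 0)"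
  by (auto simp: min_le_iff_disj Min_le_iff)

text \<open>The test function \<open>\<phi>\<close> may have slopes whose sum is below \<open>B\<close>, and then the definition of a
  sub-solution says nothing about it. If the claim failed, the conditions inside the edges would allow
  it to be replaced by a steeper one that still touches \<open>u\<close> from above and whose slopes have a sum
  larger than \<open>B\<close>.\<close>

lemma sub_solution_vertex_relaxed:
  fixes F :: "'k::finite \<Rightarrow> real \<Rightarrow> real \<Rightarrow> real \<Rightarrow> real"
  assumes cont: "\<And>i. continuous_on ({..0} \<times> UNIV \<times> UNIV) (\<lambda>(x, r, p). F i x r p)"
    and sub: "sub_solution F B u"
    and \<phi>: "\<phi> \<in> C2_junction" "local_max_at (\<lambda>q. u q - \<phi> q) vertex"
  shows "\<exists>i. \<exists>\<theta>\<in>{0..1}. F i 0 (u vertex)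
    (deriv_along \<phi> i 0 + \<theta> * neg_part ((\<Sum>j\<in>UNIV. deriv_along \<phi> j 0) - B)) \<le> 0"
proof (rule ccontr)
  define D where "D = (\<lambda>i. deriv_along \<phi> i 0)"
  define c where "c = neg_part ((\<Sum>j\<in>UNIV. D j) - B)"
  assume "\<not> ?thesis"
  then have pos: "F i 0 (u vertex) (D i + \<theta> * c) > 0" if "\<theta> \<in> {0..1}" for i \<theta>
    using that unfolding D_def c_def by (meson not_le)
  have "c \<ge> 0"
    by (auto simp: c_def neg_part_def)
  have "F i 0 (u vertex) q > 0" if "D i \<le> q" "q \<le> D i + c" for i q
  proof (cases "c = 0")
    case True
    then show ?thesis
      using that pos[of 0 i] by auto
  next
    case False
    then show ?thesis
      using that pos[of "(q - D i) / c" i] \<open>c \<ge> 0\<close> by (auto simp: field_simps)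
  qed
  then have "\<exists>e>0. \<forall>x r q. - e \<le> x \<longrightarrow> x \<le> 0 \<longrightarrow> \<bar>r - u vertex\<bar> \<le> e \<longrightarrow>
      D i - e \<le> q \<longrightarrow> q \<le> D i + c + e \<longrightarrow> F i x r q > 0" for i
    using pos_near_segment[OF cont \<open>c \<ge> 0\<close>, of "D i" i "u vertex"] by metis
  then obtain e where e: "\<And>i. e i > 0"
    "\<And>i x r q. - e i \<le> x \<Longrightarrow> x \<le> 0 \<Longrightarrow> \<bar>r - u vertex\<bar> \<le> e i \<Longrightarrow>
      D i - e i \<le> q \<Longrightarrow> q \<le> D i + c + e i \<Longrightarrow> F i x r q > 0"
    by metis
  \<comment> \<open>The shift \<open>e i / 2\<close> makes the sum of the slopes exceed \<open>B\<close> strictly and leaves room below the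
    largest forbidden slope \<open>D i + c + e i\<close>.\<close>
  define D' where "D' = (\<lambda>i. D i + c + e i / 2)"
  have usc: "upper_semicontinuous u"
    using sub by (simp add: sub_solution_def)
  have above: "\<forall>\<^sub>F x in at_left 0. u (edge i x) \<le> u vertex + D' i * x" for i
  proof (rule steeper_line_above[OF usc, of "D i - e i" "D i - e i / 2" _ "D i + c + e i"])
    show "\<forall>\<^sub>F x in at_left 0. u (edge i x) \<le> u vertex + (D i - e i / 2) * x"
    proof -
      have "\<forall>\<^sub>F x in at_left 0. \<phi> (edge i x) < \<phi> (edge i 0) + (D i - e i / 2) * x"
        using has_derivative_deriv_along[OF \<phi>(1), of 0 i] e(1)[of i]
        by (intro below_line_left_of_0) (auto simp: D_def)
      moreover have "\<forall>\<^sub>F x in at_left 0. u (edge i x) - \<phi> (edge i x) \<le> u vertex - \<phi> vertex"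
        using \<phi>(2) unfolding local_max_at_def eventually_nhds_vertex_iff by blast
      ultimately show ?thesis
        by eventually_elim simp
    qed
  next
    fix \<xi> x
    assume "\<xi> \<in> C2_junction" "local_max_at (\<lambda>r. u r - \<xi> r) (edge i x)"
      and x: "- e i \<le> x" "x < 0" "\<bar>u (edge i x) - u vertex\<bar> \<le> e i"
    then have "F i x (u (edge i x)) (deriv_along \<xi> i x) \<le> 0"
      using sub unfolding sub_solution_def by blast
    then show "deriv_along \<xi> i x \<notin> {D i - e i..D i + c + e i}"
      using e(2)[of i x "u (edge i x)" "deriv_along \<xi> i x"] x by fastforce
  qed (use e(1)[of i] \<open>c \<ge> 0\<close> in \<open>auto simp: D'_def\<close>)
  define \<eta> where "\<eta> = sum_along (\<lambda>i x. D' i * x)"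
  have lin: "((\<lambda>x. a * x) has_real_derivative a) (at x within S)" for a x S
    by (auto intro!: derivative_eq_intros)
  have "C2_on S (\<lambda>x. a * x)" for a S
    unfolding C2_on_def using lin
    by (intro exI[of _ "\<lambda>_. a"] exI[of _ "\<lambda>_. 0"]) auto
  then have "\<eta> \<in> C2_junction"
    unfolding \<eta>_def by (intro sum_along_in_C2_junction) auto
  moreover have "local_max_at (\<lambda>q. u q - \<eta> q) vertex"
  proof -
    have \<eta>_edge: "\<eta> (edge i x) = D' i * x" if "x \<le> 0" for i x
      unfolding \<eta>_def using that by (simp add: sum_along_edge)
    have "\<eta> vertex = 0"
      using \<eta>_edge[of 0] by simp
    have "\<forall>\<^sub>F x in at_left 0. u (edge i x) - \<eta> (edge i x) \<le> u vertex - \<eta> vertex" for i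
    proof -
      have "\<forall>\<^sub>F x in at_left (0::real). x < 0"
        by (simp add: eventually_at_filter)
      with above[of i] show ?thesis
        by eventually_elim (simp add: \<eta>_edge \<open>\<eta> vertex = 0\<close>)
    qed
    then show ?thesis
      unfolding local_max_at_def eventually_nhds_vertex_iff by blast
  qed
  moreover have "deriv_along \<eta> i 0 = D' i" for i
    unfolding \<eta>_def using lin by (intro deriv_along_eqI has_derivative_sum_along) auto
  ultimately have "min ((\<Sum>i\<in>UNIV. D' i) - B) (MIN i. F i 0 (u vertex) (D' i)) \<le> 0"
    using sub unfolding sub_solution_def by force
  moreover have "F i 0 (u vertex) (D' i) > 0" for i
    using e(1)[of i] \<open>c \<ge> 0\<close> by (intro e(2)) (auto simp: D'_def)
  moreover have "(\<Sum>i\<in>UNIV. D' i) > B"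
  proof -
    \<comment> \<open>There is at least one edge, so adding \<open>c\<close> to every slope makes up for the deficit.\<close>
    have "c \<le> of_nat CARD('k) * c"
      using \<open>c \<ge> 0\<close> mult_right_mono[of 1 "real CARD('k)" c] by (simp add: Suc_le_eq)
    moreover have "(\<Sum>i\<in>UNIV. D i) + c \<ge> B"
      by (auto simp: c_def neg_part_def)
    moreover have "(\<Sum>i\<in>UNIV. e i / 2) > 0"
      using e(1) by (intro sum_pos) auto
    ultimately show ?thesis
      by (simp add: D'_def sum.distrib)
  qed
  ultimately show False
    unfolding min_flux_nonpos_iff by (meson diff_le_0_iff_le not_le)
qed

theorem proposition10:
  fixes F :: "'k::finite \<Rightarrow> real \<Rightarrow> real \<Rightarrow> real \<Rightarrow> real"
    and B :: real
    and u :: "'k junction \<Rightarrow> real"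
  assumes "\<And>i. continuous_on ({..0} \<times> UNIV \<times> UNIV) (\<lambda>(x, r, p). F i x r p)"
    and "upper_semicontinuous u"
  shows "sub_solution F B u \<longleftrightarrow>
    (\<forall>\<phi>\<in>C2_junction. \<forall>p. local_max_at (\<lambda>q. u q - \<phi> q) p \<longrightarrow>
       (\<forall>i x. x < 0 \<and> p = edge i x \<longrightarrow> F i x (u p) (deriv_along \<phi> i x) \<le> 0) \<and>
       (p = vertex \<longrightarrow>
          (INF (i, \<theta>)\<in>UNIV \<times> {0..1}.
             F i 0 (u vertex)
               (deriv_along \<phi> i 0 + \<theta> * neg_part ((\<Sum>j\<in>UNIV. deriv_along \<phi> j 0) - B))) \<le> 0))"
  (is "_ \<longleftrightarrow> ?relaxed")
proof
  assume sub: "sub_solution F B u"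
  show ?relaxed
    using sub sub_solution_vertex_relaxed[OF assms(1) sub]
    unfolding INF_nonpos_iff[OF assms(1)] sub_solution_def by blast
next
  assume relaxed: ?relaxed
  show "sub_solution F B u"
    unfolding sub_solution_def min_flux_nonpos_iff
  proof (intro conjI assms(2) ballI allI impI)
    fix \<phi> p i x
    assume "\<phi> \<in> C2_junction" "local_max_at (\<lambda>q. u q - \<phi> q) p" "x < 0 \<and> p = edge i x"
    then show "F i x (u p) (deriv_along \<phi> i x) \<le> 0"
      using relaxed by blast
  next
    fix \<phi> p
    assume "\<phi> \<in> C2_junction" "local_max_at (\<lambda>q. u q - \<phi> q) p" "p = vertex"
    then obtain i \<theta> where i: "F i 0 (u vertex)
        (deriv_along \<phi> i 0 + \<theta> * neg_part ((\<Sum>j\<in>UNIV. deriv_along \<phi> j 0) - B)) \<le> 0"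
      using relaxed unfolding INF_nonpos_iff[OF assms(1)] by blast
    show "(\<Sum>i\<in>UNIV. deriv_along \<phi> i 0) - B \<le> 0 \<or> (\<exists>i. F i 0 (u vertex) (deriv_along \<phi> i 0) \<le> 0)"
    proof (cases "(\<Sum>i\<in>UNIV. deriv_along \<phi> i 0) - B \<le> 0")
      case False
      then have "neg_part ((\<Sum>j\<in>UNIV. deriv_along \<phi> j 0) - B) = 0"
        by (simp add: neg_part_def)
      then show ?thesis
        using i by auto
    qed simp
  qed
qed

end
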